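(* Let $n > k$ and $m$ be positive integers and $H > 0$. Let $\Pi$ be any set of linear-programming instances $\pi = (\bm{c}, \bm{A}, \bm{b}) \in \mathbb{R}^n \times \mathbb{R}^{m\times n} \times \mathbb{R}^m$, each representing the LP $\max\{\bm{c}^\top \bm{x} : \bm{A}\bm{x} \le \bm{b},\ \bm{x}\in\mathbb{R}^n\}$, such that for every $\pi \in \Pi$, $\bm{x} = \mathbf{0}_n$ is feasible and the optimal value is at most $H$. For $\bm{P} \in \mathbb{R}^{n\times k}$ and $\pi = (\bm{c},\bm{A},\bm{b}) \in \Pi$ define $u(\bm{P}, \pi) = \max\{\bm{c}^\top \bm{P}\bm{y} : \bm{A}\bm{P}\bm{y} \le \bm{b},\ \bm{y} \in \mathbb{R}^k\}$, and let $\mathcal{U} = \{u(\bm{P}, \cdot) : \Pi \to \mathbb{R} \mid \bm{P} \in \mathbb{R}^{n\times k}\}$. Then $\mathrm{pdim}(\mathcal{U}) = \mathrm{O}(nk^2 \log(mk))$, where the constant hidden in $\mathrm{O}$ is absolute (independent of $n, k, m, H$ and $\Pi$).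
   Context: Pseudo-dimension: for a class $\mathcal{U}$ of real-valued functions on a set $\Pi$, a finite set $\{\pi_1,\dots,\pi_N\} \subseteq \Pi$ is shattered by $\mathcal{U}$ if there exist thresholds $t_1,\dots,t_N \in \mathbb{R}$ such that each of the $2^N$ possible outcomes of the family of indicators $(\mathbb{1}[u(\pi_i) \ge t_i])_{i=1}^N$ is realized by some $u \in \mathcal{U}$. $\mathrm{pdim}(\mathcal{U})$ is the maximum size of a set shattered by $\mathcal{U}$. Under the stated assumptions $u(\bm{P},\pi) \in [0,H]$ for all $\bm{P}$ and $\pi$ (since $\bm{y}=\mathbf{0}_k$ is feasible and $\bm{P}\bm{y}$ is feasible for the original LP).
   Formalization: The factor log(mk) is read as max(1, ln(mk)), since for m = k = 1 the logarithm is 0 while the pseudo-dimension can be at least 1; for mk ≥ 2 the two bounds agree up to an absolute constant. *)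

theory Defs
  imports "HOL-Analysis.Analysis" "HOL-Library.Extended_Nat"
begin

text \<open>Vectors in R^d are functions nat => real (indices 0..d-1 meaningful);
  matrices R^(r x s) are functions nat => nat => real (row, column).
  An LP instance (c, A, b) with n variables and m constraints is stored as a triple,
  required to be zero outside the meaningful index range so that each LP has a unique
  representation.\<close>

type_synonym lp_inst = "(nat \<Rightarrow> real) \<times> (nat \<Rightarrow> nat \<Rightarrow> real) \<times> (nat \<Rightarrow> real)"

definition lp_instances :: "nat \<Rightarrow> nat \<Rightarrow> lp_inst set" where
  "lp_instances n m = {(c, A, b).
      (\<forall>i\<ge>n. c i = 0) \<and> (\<forall>r j. r \<ge> m \<or> j \<ge> n \<longrightarrow> A r j = 0) \<and> (\<forall>r\<ge>m. b r = 0)}"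

definition lp_feasible :: "nat \<Rightarrow> nat \<Rightarrow> lp_inst \<Rightarrow> (nat \<Rightarrow> real) \<Rightarrow> bool" where
  "lp_feasible n m \<pi> x = (case \<pi> of (c, A, b) \<Rightarrow> \<forall>r<m. (\<Sum>i<n. A r i * x i) \<le> b r)"

definition lp_obj :: "nat \<Rightarrow> lp_inst \<Rightarrow> (nat \<Rightarrow> real) \<Rightarrow> real" where
  "lp_obj n \<pi> x = (case \<pi> of (c, A, b) \<Rightarrow> \<Sum>i<n. c i * x i)"

definition mat_vec :: "nat \<Rightarrow> (nat \<Rightarrow> nat \<Rightarrow> real) \<Rightarrow> (nat \<Rightarrow> real) \<Rightarrow> (nat \<Rightarrow> real)" where
  "mat_vec k P y = (\<lambda>i. \<Sum>j<k. P i j * y j)"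

definition proj_lp_val :: "nat \<Rightarrow> nat \<Rightarrow> nat \<Rightarrow> (nat \<Rightarrow> nat \<Rightarrow> real) \<Rightarrow> lp_inst \<Rightarrow> real" where
  "proj_lp_val n k m P \<pi> =
     Sup {lp_obj n \<pi> (mat_vec k P y) | y. lp_feasible n m \<pi> (mat_vec k P y)}"

definition pshatters :: "('a \<Rightarrow> real) set \<Rightarrow> 'a set \<Rightarrow> bool" where
  "pshatters U S = (\<exists>t :: 'a \<Rightarrow> real. \<forall>B \<subseteq> S. \<exists>u\<in>U. \<forall>x\<in>S. (t x \<le> u x) = (x \<in> B))"

definition pdim_on :: "'a set \<Rightarrow> ('a \<Rightarrow> real) set \<Rightarrow> enat" where
  "pdim_on X U = Sup {enat (card S) | S. finite S \<and> S \<subseteq> X \<and> pshatters U S}"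

end

theory Submission
  imports Defs "HOL-Library.Function_Algebras"
begin

text \<open>Whether the projected LP reaches a threshold depends only on the signs of at most
  (m + 2)^(k + 1) polynomials of degree at most 3^k in the nk entries of P. To see this, eliminate
  the variables one by one: a feasible point can be moved along the last coordinate until some
  constraint involving it is tight (or the coordinate can be set to 0), so feasibility is a
  disjunction of at most m + 2 systems with one variable less.

  The number of sign patterns of N polynomials of degree d in p variables is then bounded in the
  style of Warren: split the polynomials into p blocks with products F_b, and on each sign cell
  minimise the sum of (z_b F_b(x) - 1)^2 over b plus a small multiple of the even powers of all
  coordinates. The minimisers are critical points, and each coordinate of a critical point has its
  top power equal to a polynomial of lower degree, so Bezout's bound is elementary here. A shattered set
  of size nkr yields 2^(nkr) patterns with blocks of r instances each, which bounds r by
  O(k log(mk)).\<close>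

subsection \<open>Polynomial functions\<close>

text \<open>Real functions as a pointwise vector space. Linear independence and the exchange bound
  for spans in this space later count critical points.\<close>

interpretation fv: vector_space "\<lambda>(c::real) (f::'a \<Rightarrow> real) x. c * f x"
  by unfold_locales (auto simp: fun_eq_iff algebra_simps)

definition mon :: "nat \<Rightarrow> (nat \<Rightarrow> nat) \<Rightarrow> (nat \<Rightarrow> real) \<Rightarrow> real" where
  "mon q \<alpha> x = (\<Prod>i<q. x i ^ \<alpha> i)"

text \<open>Polynomials are taken as functions, in the span of the monomials, so that restricting
  them to a finite set of points stays within linear algebra.\<close>

definition pols :: "nat \<Rightarrow> nat \<Rightarrow> ((nat \<Rightarrow> real) \<Rightarrow> real) set" where
  "pols q D = fv.span {mon q \<alpha> | \<alpha>. (\<Sum>i<q. \<alpha> i) \<le> D}"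

lemma pols_mono: "D \<le> D' \<Longrightarrow> pols q D \<subseteq> pols q D'"
  unfolding pols_def by (intro fv.span_mono) auto

lemma pols_mon: "(\<Sum>i<q. \<alpha> i) \<le> D \<Longrightarrow> mon q \<alpha> \<in> pols q D"
  unfolding pols_def by (intro fv.span_base) auto

lemma pols_add: "f \<in> pols q D \<Longrightarrow> g \<in> pols q D \<Longrightarrow> (\<lambda>x. f x + g x) \<in> pols q D"
  unfolding pols_def using fv.span_add[of f _ g] by (simp add: plus_fun_def)

lemma pols_scale: "f \<in> pols q D \<Longrightarrow> (\<lambda>x. c * f x) \<in> pols q D"
  unfolding pols_def by (rule fv.span_scale)

lemma pols_zero: "(\<lambda>x. 0) \<in> pols q D"
  unfolding pols_def using fv.span_zero by (simp add: zero_fun_def)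

lemma pols_diff: "f \<in> pols q D \<Longrightarrow> g \<in> pols q D \<Longrightarrow> (\<lambda>x. f x - g x) \<in> pols q D"
  using pols_add[of f q D "\<lambda>x. (-1) * g x"] pols_scale[of g q D "-1"] by simp

lemma pols_sum: "(\<And>i. i \<in> A \<Longrightarrow> f i \<in> pols q D) \<Longrightarrow> (\<lambda>x. \<Sum>i\<in>A. f i x) \<in> pols q D"
  by (induction A rule: infinite_finite_induct) (auto intro: pols_add pols_zero)

lemma pols_const: "(\<lambda>x. c) \<in> pols q D"
proof -
  have "mon q (\<lambda>_. 0) \<in> pols q D" by (rule pols_mon) simp
  from pols_scale[OF this, of c] show ?thesis by (simp add: mon_def)
qed

lemma pols_var: "i < q \<Longrightarrow> (\<lambda>x. x i) \<in> pols q 1"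
proof -
  assume "i < q"
  have "mon q (\<lambda>j. if j = i then 1 else 0) \<in> pols q 1"
    by (rule pols_mon) (use \<open>i < q\<close> in simp)
  moreover have "mon q (\<lambda>j. if j = i then 1 else 0) = (\<lambda>x. x i)"
    using \<open>i < q\<close> by (auto simp: mon_def fun_eq_iff if_distrib[of "\<lambda>e. _ ^ e"] cong: if_cong)
  ultimately show ?thesis by simp
qed

lemma pols_induct [consumes 1, case_names zero add]:
  assumes "f \<in> pols q D" and "P (\<lambda>x. 0)"
    and "\<And>c \<alpha> g. (\<Sum>i<q. \<alpha> i) \<le> D \<Longrightarrow> g \<in> pols q D \<Longrightarrow> P g \<Longrightarrow> P (\<lambda>x. c * mon q \<alpha> x + g x)"
  shows "P f"
proof -
  have "f \<in> pols q D \<and> P f"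
    using assms(1) unfolding pols_def
  proof (rule fv.span_induct_alt)
    show "0 \<in> fv.span {mon q \<alpha> |\<alpha>. sum \<alpha> {..<q} \<le> D} \<and> P 0"
      using assms(2) pols_zero[of q D] by (simp add: zero_fun_def pols_def)
    fix c g h
    assume "g \<in> {mon q \<alpha> |\<alpha>. sum \<alpha> {..<q} \<le> D}"
      and h: "h \<in> fv.span {mon q \<alpha> |\<alpha>. sum \<alpha> {..<q} \<le> D} \<and> P h"
    then obtain \<alpha> where \<alpha>: "g = mon q \<alpha>" "sum \<alpha> {..<q} \<le> D" by auto
    have "(\<lambda>x. c * mon q \<alpha> x + h x) \<in> pols q D"
      using h \<alpha> by (intro pols_add pols_scale pols_mon) (auto simp: pols_def)
    then show "(\<lambda>x. c * g x) + h \<in> fv.span {mon q \<alpha> |\<alpha>. sum \<alpha> {..<q} \<le> D} \<and> P ((\<lambda>x. c * g x) + h)"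
      using assms(3)[of \<alpha> h c] h \<alpha> by (simp add: plus_fun_def pols_def)
  qed
  then show ?thesis ..
qed

lemma pols_mult:
  assumes "f \<in> pols q D" "g \<in> pols q D'"
  shows "(\<lambda>x. f x * g x) \<in> pols q (D + D')"
  using assms(1)
proof (induction rule: pols_induct)
  case zero
  then show ?case using pols_zero by simp
next
  case (add c \<alpha> f)
  have "(\<lambda>x. mon q \<alpha> x * g x) \<in> pols q (D + D')"
    using assms(2)
  proof (induction rule: pols_induct)
    case zero
    then show ?case using pols_zero by simp
  next
    case (add c \<beta> g)
    have "mon q (\<lambda>i. \<alpha> i + \<beta> i) \<in> pols q (D + D')"
      by (rule pols_mon) (use add \<open>sum \<alpha> {..<q} \<le> D\<close> in \<open>simp add: sum.distrib add_mono\<close>)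
    from pols_add[OF pols_scale[OF this, of c] add(3)] show ?case
      by (simp add: mon_def power_add prod.distrib algebra_simps)
  qed
  from pols_add[OF pols_scale[OF this, of c] add(3)] show ?case
    by (simp add: algebra_simps)
qed

lemma pols_prod:
  assumes "finite A" "\<And>i. i \<in> A \<Longrightarrow> f i \<in> pols q D"
  shows "(\<lambda>x. \<Prod>i\<in>A. f i x) \<in> pols q (card A * D)"
  using assms
proof (induction A rule: finite_induct)
  case empty
  then show ?case using pols_const by simp
next
  case (insert a A)
  from pols_mult[of "f a" q D, OF _ insert.IH] insert show ?case by simp
qed

lemma pols_cong:
  assumes "f \<in> pols q D" "\<And>i. i < q \<Longrightarrow> x i = y i"
  shows "f x = f y"
  using assms(1) by (induction rule: pols_induct) (auto simp: mon_def assms(2))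

lemma pols_vars_mono:
  assumes "f \<in> pols p D" "p \<le> q"
  shows "f \<in> pols q D"
  using assms(1)
proof (induction rule: pols_induct)
  case zero
  then show ?case by (rule pols_zero)
next
  case (add c \<alpha> g)
  \<comment> \<open>\<open>\<alpha>\<close> is arbitrary from index \<open>p\<close> on; the
    exponents there are reset to 0 so that the monomial stays the same when read in \<open>q\<close>
    variables.\<close>
  let ?\<beta> = "\<lambda>i. if i < p then \<alpha> i else 0"
  have [simp]: "{..<q} \<inter> {i. i < p} = {..<p}" using assms(2) by auto
  have "sum ?\<beta> {..<q} = sum \<alpha> {..<p}" by (simp add: sum.If_cases)
  then have "mon q ?\<beta> \<in> pols q D" using add(1) by (intro pols_mon) simp
  moreover have "mon q ?\<beta> = mon p \<alpha>"
    by (auto simp: mon_def fun_eq_iff if_distrib[of "\<lambda>e. _ ^ e"] prod.If_cases cong: if_cong)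
  ultimately show ?case using pols_add[OF pols_scale add(3)] by simp
qed

lemma pols_continuous: "f \<in> pols q D \<Longrightarrow> continuous_on UNIV f"
proof (induction rule: pols_induct)
  case zero
  then show ?case by simp
next
  case (add c \<alpha> g)
  then show ?case unfolding mon_def
    by (intro continuous_intros continuous_on_product_coordinates) auto
qed

text \<open>Differentiate monomial by monomial. The degree bound \<open>D\<close> is not lowered: it
  only has to stay below the exponent \<open>D + 1\<close> of the leading power in the
  critical-point equations.\<close>

lemma pols_deriv:
  assumes "f \<in> pols q D"
  shows "\<exists>g\<in>pols q D. \<forall>x. ((\<lambda>s. f (x(i := s))) has_real_derivative g x) (at (x i))"
  using assms
proof (induction rule: pols_induct)
  case zero
  then show ?case using pols_zero by (intro bexI[of _ "\<lambda>_. 0"]) auto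
next
  case (add c \<alpha> f)
  then obtain g where g: "g \<in> pols q D"
    "\<And>x. ((\<lambda>s. f (x(i := s))) has_real_derivative g x) (at (x i))" by blast
  have "\<exists>h\<in>pols q D. \<forall>x. ((\<lambda>s. mon q \<alpha> (x(i := s))) has_real_derivative h x) (at (x i))"
  proof (cases "i < q")
    case False
    then have "mon q \<alpha> (x(i := s)) = mon q \<alpha> x" for x s
      by (auto simp: mon_def intro!: prod.cong)
    then show ?thesis using pols_zero by (intro bexI[of _ "\<lambda>_. 0"]) auto
  next
    case True
    \<comment> \<open>For \<open>\<alpha> i = 0\<close> the subtraction is truncated, but then the
      factor \<open>real (\<alpha> i)\<close> makes the derivative 0.\<close>
    let ?\<beta> = "\<alpha>(i := \<alpha> i - 1)"
    have eq: "mon q \<gamma> y = y i ^ \<gamma> i * (\<Prod>j\<in>{..<q}-{i}. y j ^ \<gamma> j)" for \<gamma> y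
      unfolding mon_def using True by (subst prod.remove[of _ i]) auto
    have 1: "mon q \<alpha> (x(i := s)) = s ^ \<alpha> i * (\<Prod>j\<in>{..<q}-{i}. x j ^ \<alpha> j)" for x s
      by (subst eq) (auto intro!: prod.cong)
    have 2: "mon q ?\<beta> x = x i ^ (\<alpha> i - 1) * (\<Prod>j\<in>{..<q}-{i}. x j ^ \<alpha> j)" for x
      by (subst eq) (auto intro!: prod.cong)
    have "sum ?\<beta> {..<q} \<le> sum \<alpha> {..<q}" by (intro sum_mono) auto
    then have "(\<lambda>x. real (\<alpha> i) * mon q ?\<beta> x) \<in> pols q D"
      using add(1) by (intro pols_scale pols_mon) simp
    moreover have "((\<lambda>s. mon q \<alpha> (x(i := s))) has_real_derivative real (\<alpha> i) * mon q ?\<beta> x) (at (x i))" for x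
      unfolding 1 2 by (auto intro!: derivative_eq_intros)
    ultimately show ?thesis by (intro bexI[of _ "\<lambda>x. real (\<alpha> i) * mon q ?\<beta> x"] allI)
  qed
  then obtain h where h: "h \<in> pols q D"
    "\<And>x. ((\<lambda>s. mon q \<alpha> (x(i := s))) has_real_derivative h x) (at (x i))" by blast
  show ?case
  proof (intro bexI[of _ "\<lambda>x. c * h x + g x"] allI)
    show "(\<lambda>x. c * h x + g x) \<in> pols q D" using g h by (intro pols_add pols_scale)
    show "((\<lambda>s. c * mon q \<alpha> (x(i := s)) + f (x(i := s))) has_real_derivative c * h x + g x) (at (x i))" for x
      by (intro derivative_intros DERIV_cmult g h)
  qed
qed

text \<open>On Z every monomial reduces to one with all exponents below E, while the
  polynomials restricted to Z span all functions on Z by interpolation.\<close>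

lemma card_zeros_le:
  assumes Z: "finite Z" "\<And>x i. x \<in> Z \<Longrightarrow> i \<ge> q \<Longrightarrow> x i = 0"
    and h: "\<And>i. i < q \<Longrightarrow> h i \<in> pols q D" "\<And>i x. i < q \<Longrightarrow> x \<in> Z \<Longrightarrow> x i ^ E = h i x"
    and DE: "D < E"
  shows "card Z \<le> E ^ q"
proof -
  \<comment> \<open>Cutting functions off outside \<open>Z\<close> turns equality on
    \<open>Z\<close> into equality of functions, so restriction needs no separate vector
    space.\<close>
  define \<rho> where "\<rho> f = (\<lambda>x. if x \<in> Z then f x else 0)" for f :: "(nat \<Rightarrow> real) \<Rightarrow> real"
  define T where "T = (\<lambda>\<alpha>. \<rho> (mon q \<alpha>)) ` ({..<q} \<rightarrow>\<^sub>E {..<E})"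
  have T: "finite T" "card T \<le> E ^ q"
  proof -
    have fin: "finite ({..<q} \<rightarrow>\<^sub>E {..<E})" by (intro finite_PiE) auto
    show "finite T" unfolding T_def using fin by simp
    have "card T \<le> card ({..<q} \<rightarrow>\<^sub>E {..<E})" unfolding T_def by (rule card_image_le[OF fin])
    then show "card T \<le> E ^ q" by (simp add: card_PiE)
  qed
  \<comment> \<open>Strong induction on the degree: on \<open>Z\<close>, replacing
    \<open>x i ^ E\<close> by \<open>h i\<close> trades degree \<open>E\<close> for degree at most
    \<open>D < E\<close>.\<close>
  have red: "\<rho> f \<in> fv.span T" if "f \<in> pols q D'" for f D'
    using that
  proof (induction D' arbitrary: f rule: less_induct)
    case (less D')
    have mon: "\<rho> (mon q \<alpha>) \<in> fv.span T" if \<alpha>: "sum \<alpha> {..<q} \<le> D'" for \<alpha>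
    proof (cases "\<forall>i<q. \<alpha> i < E")
      case True
      then have "restrict \<alpha> {..<q} \<in> {..<q} \<rightarrow>\<^sub>E {..<E}" by auto
      moreover have "mon q (restrict \<alpha> {..<q}) = mon q \<alpha>" by (auto simp: mon_def)
      ultimately have "\<rho> (mon q \<alpha>) \<in> T"
        unfolding T_def by (intro image_eqI[of _ _ "restrict \<alpha> {..<q}"]) simp_all
      then show ?thesis by (rule fv.span_base)
    next
      case False
      then obtain i where i: "i < q" "\<alpha> i \<ge> E" by auto
      let ?\<beta> = "\<alpha>(i := \<alpha> i - E)"
      have "sum \<alpha> {..<q} = \<alpha> i + sum \<alpha> ({..<q} - {i})"
        using i by (subst sum.remove[of _ i]) auto
      moreover have "sum ?\<beta> {..<q} = (\<alpha> i - E) + sum \<alpha> ({..<q} - {i})"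
        using i by (subst sum.remove[of _ i]) auto
      ultimately have *: "sum ?\<beta> {..<q} + E \<le> D'" using i \<alpha> by simp
      have "(\<lambda>x. mon q ?\<beta> x * h i x) \<in> pols q (sum ?\<beta> {..<q} + D)"
        by (intro pols_mult pols_mon h i) simp
      then have "\<rho> (\<lambda>x. mon q ?\<beta> x * h i x) \<in> fv.span T"
        by (rule less.IH[rotated]) (use * DE in simp)
      moreover have "\<rho> (\<lambda>x. mon q ?\<beta> x * h i x) = \<rho> (mon q \<alpha>)"
      proof -
        have eq: "mon q \<gamma> y = y i ^ \<gamma> i * (\<Prod>j\<in>{..<q}-{i}. y j ^ \<gamma> j)" for \<gamma> y
          unfolding mon_def using i by (subst prod.remove[of _ i]) auto
        have "mon q ?\<beta> x * h i x = mon q \<alpha> x" if "x \<in> Z" for x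
        proof -
          have "x i ^ \<alpha> i = x i ^ (\<alpha> i - E) * h i x"
            using i h(2)[OF i(1) that] by (metis le_add_diff_inverse2 power_add)
          moreover have "(\<Prod>j\<in>{..<q}-{i}. x j ^ ?\<beta> j) = (\<Prod>j\<in>{..<q}-{i}. x j ^ \<alpha> j)"
            by (intro prod.cong) auto
          ultimately show ?thesis unfolding eq[of ?\<beta>] eq[of \<alpha>] by simp
        qed
        then show ?thesis by (auto simp: \<rho>_def)
      qed
      ultimately show ?thesis by simp
    qed
    from less.prems show ?case
    proof (induction rule: pols_induct)
      case zero
      have "\<rho> (\<lambda>x. 0) = 0" by (auto simp: \<rho>_def)
      then show ?case using fv.span_zero[of T] by (simp only:)
    next
      case (add c \<alpha> g)
      have "\<rho> (\<lambda>x. c * mon q \<alpha> x + g x) = (\<lambda>x. c * \<rho> (mon q \<alpha>) x) + \<rho> g"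
        by (auto simp: \<rho>_def)
      then show ?case using fv.span_add[OF fv.span_scale[OF mon[OF add(1)]] add(3)] by (simp only:)
    qed
  qed
  define e where "e z = (\<lambda>x. if x = z then 1 else 0 :: real)" for z :: "nat \<Rightarrow> real"
  have inj: "inj_on e Z" by (auto simp: inj_on_def e_def fun_eq_iff split: if_splits)
  have sub: "e ` Z \<subseteq> fv.span T"
  proof
    fix u assume "u \<in> e ` Z"
    then obtain z where z: "z \<in> Z" "u = e z" by auto
    \<comment> \<open>All points of \<open>Z\<close> vanish from coordinate \<open>q\<close> on, so
      distinct ones differ below \<open>q\<close>. The coordinates \<open>j z'\<close> chosen this
      way build an interpolation polynomial \<open>?f\<close> that is 1 at \<open>z\<close> and 0 on
      the rest of \<open>Z\<close>.\<close>
    have "\<exists>i<q. z i \<noteq> z' i" if "z' \<in> Z - {z}" for z'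
      using that z Z(2) by (metis DiffE ext insertI1 not_le)
    then obtain j where j: "\<And>z'. z' \<in> Z - {z} \<Longrightarrow> j z' < q \<and> z (j z') \<noteq> z' (j z')" by metis
    let ?f = "\<lambda>x. \<Prod>z'\<in>Z - {z}. (1 / (z (j z') - z' (j z'))) * (x (j z') - z' (j z'))"
    have f: "?f \<in> pols q (card (Z - {z}) * 1)"
      by (intro pols_prod pols_scale pols_diff pols_var pols_const) (use Z j in auto)
    have "\<rho> ?f = e z"
    proof
      fix x
      show "\<rho> ?f x = e z x"
      proof (cases "x \<in> Z - {z}")
        case True
        then have "?f x = 0" using Z by (intro prod_zero) auto
        with True show ?thesis unfolding \<rho>_def e_def by simp
      next
        case False
        have 1: "?f z = 1" using j by (intro prod.neutral) auto
        show ?thesis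
        proof (cases "x = z")
          case True
          show ?thesis unfolding True \<rho>_def e_def using z(1) 1 by (simp only: if_True refl)
        next
          case neq: False
          then have "x \<notin> Z" using False by blast
          then show ?thesis unfolding \<rho>_def e_def using neq by (simp only: if_False)
        qed
      qed
    qed
    then show "u \<in> fv.span T" using red[OF f] z(2) by (simp only:)
  qed
  \<comment> \<open>Evaluating a vanishing combination of the indicators at \<open>z\<close>
    isolates the coefficient of \<open>e z\<close>.\<close>
  have "fv.independent (e ` Z)"
  proof
    assume "fv.dependent (e ` Z)"
    from iffD1[OF fv.dependent_finite[OF finite_imageI[OF Z(1)]] this]
    obtain c where c: "\<exists>v\<in>e ` Z. c v \<noteq> 0" "(\<Sum>v\<in>e ` Z. (\<lambda>x. c v * v x)) = 0"
      by (elim exE conjE)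
    from c(1) obtain z where z: "z \<in> Z" "c (e z) \<noteq> 0" by blast
    have apply_sum: "(\<Sum>w\<in>A. g w) z = (\<Sum>w\<in>A. g w z)" if "finite A" for A and g :: "(nat \<Rightarrow> real) \<Rightarrow> (nat \<Rightarrow> real) \<Rightarrow> real"
      using that by (induction A rule: finite_induct) auto
    have "(\<Sum>w\<in>Z. (\<lambda>x. c (e w) * e w x)) = 0"
      using c(2) inj by (simp add: sum.reindex)
    then have "(\<Sum>w\<in>Z. c (e w) * e w z) = 0"
      using apply_sum[OF Z(1), of "\<lambda>w x. c (e w) * e w x"] by simp
    moreover have "(\<Sum>w\<in>Z. c (e w) * e w z) = (\<Sum>w\<in>Z. if w = z then c (e z) else 0)"
      by (intro sum.cong) (auto simp: e_def)
    ultimately show False using z Z(1) by simp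
  qed
  then have "card (e ` Z) \<le> card T"
    using fv.independent_span_bound[OF T(1) _ sub] by simp
  then show ?thesis using T inj by (simp add: card_image)
qed

subsection \<open>Counting sign patterns\<close>

text \<open>Tychonoff: the set is a product of compact intervals, with the factor {0} from
  coordinate \<open>q\<close> on.\<close>

lemma compact_box:
  fixes R :: real
  shows "compact {x :: nat \<Rightarrow> real. (\<forall>i<q. \<bar>x i\<bar> \<le> R) \<and> (\<forall>i\<ge>q. x i = 0)}" (is "compact ?B")
proof -
  let ?K = "\<lambda>i. if i < q then {-R..R} else {0::real}"
  have "compactin (product_topology (\<lambda>_. euclidean) UNIV) (PiE UNIV ?K)"
    unfolding compactin_PiE by auto
  then have "compact (PiE UNIV ?K)" by (simp add: euclidean_product_topology)
  moreover have "PiE UNIV ?K = ?B"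
    by (auto simp: PiE_def Pi_iff abs_le_iff minus_le_iff split: if_splits)
  ultimately show ?thesis by simp
qed

text \<open>Multiplying the polynomials only within each of the p' blocks, at the price of one
  extra variable per block, keeps the degree of the objective proportional to the block size w.
  This is what gives w (and not the total number of polynomials) as the base of the bound.\<close>

lemma card_sign_patterns_le:
  fixes Fs :: "nat \<Rightarrow> ((nat \<Rightarrow> real) \<Rightarrow> real) set"
  assumes Fs: "\<And>b. b < p' \<Longrightarrow> finite (Fs b)" "\<And>b. b < p' \<Longrightarrow> card (Fs b) \<le> w"
      "\<And>b. b < p' \<Longrightarrow> Fs b \<subseteq> pols p d"
    and X: "finite X"
      "\<And>x y. x \<in> X \<Longrightarrow> y \<in> X \<Longrightarrow> x \<noteq> y \<Longrightarrow> \<exists>b<p'. \<exists>f\<in>Fs b. (0 \<le> f x) \<noteq> (0 \<le> f y)"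
  shows "card X \<le> (2 * w * d + 3) ^ (p + p')"
proof -
  define q where "q = p + p'"
  \<comment> \<open>\<open>\<delta>\<close> is half the least absolute value among the negative
    values on \<open>X\<close>. Adding it makes every value nonzero and turns weak signs into strict
    ones; the inserted 1 covers the case without negative values.\<close>
  obtain \<delta> where \<delta>: "\<delta> > 0" "\<And>x b f. x \<in> X \<Longrightarrow> b < p' \<Longrightarrow> f \<in> Fs b \<Longrightarrow> f x < 0 \<Longrightarrow> f x + \<delta> < 0"
  proof -
    let ?V = "{- f x | f x b. b < p' \<and> f \<in> Fs b \<and> x \<in> X \<and> f x < 0}"
    have "?V \<subseteq> (\<lambda>(f, x). - f x) ` ((\<Union>b<p'. Fs b) \<times> X)" by force
    moreover have "finite ((\<lambda>(f, x). - f x) ` ((\<Union>b<p'. Fs b) \<times> X))"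
      using Fs(1) X(1) by auto
    ultimately have fin: "finite (insert 1 ?V)" using finite_subset by auto
    define \<delta> where "\<delta> = Min (insert 1 ?V) / 2"
    have pos: "0 < Min (insert 1 ?V)" using fin by (subst Min_gr_iff) auto
    show ?thesis
    proof (rule that[of \<delta>])
      show "\<delta> > 0" using pos by (simp add: \<delta>_def)
      fix x b f assume "x \<in> X" "b < p'" "f \<in> Fs b" "f x < 0"
      then have "- f x \<in> insert 1 ?V" by blast
      then have "Min (insert 1 ?V) \<le> - f x" using fin by (intro Min_le)
      then show "f x + \<delta> < 0" using pos by (simp add: \<delta>_def field_simps)
    qed
  qed
  define F where "F b x = (\<Prod>f\<in>Fs b. f x + \<delta>)" for b x
  \<comment> \<open>The coordinate \<open>p + b\<close> plays the role of the inverse of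
    \<open>F b x\<close>. Thus \<open>L0\<close> can vanish only where all \<open>F b\<close> are
    nonzero, and \<open>D\<close> below bounds its degree.\<close>
  define L0 where "L0 x = (\<Sum>b<p'. (x (p + b) * F b x - 1) ^ 2)" for x
  define D where "D = 2 * (w * d + 1)"
  have F: "F b \<in> pols p (w * d)" if "b < p'" for b
  proof -
    have "F b \<in> pols p (card (Fs b) * d)"
      unfolding F_def using Fs that by (intro pols_prod pols_add pols_const) auto
    then show ?thesis using Fs(2)[OF that] pols_mono[of "card (Fs b) * d" "w * d" p] by auto
  qed
  have fq: "f \<in> pols q d" if "b < p'" "f \<in> Fs b" for b f
    using Fs(3) that pols_vars_mono[of f p d q] by (auto simp: q_def)
  have L0: "L0 \<in> pols q D"
  proof -
    have "(\<lambda>x. x (p + b) * F b x - 1) \<in> pols q (1 + w * d)" if "b < p'" for b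
      using that pols_vars_mono[OF F[OF that], of q]
      by (intro pols_diff pols_mult pols_var pols_const) (auto simp: q_def)
    then have "(\<lambda>x. \<Sum>b<p'. (x (p + b) * F b x - 1) * (x (p + b) * F b x - 1)) \<in> pols q ((1 + w * d) + (1 + w * d))"
      by (intro pols_sum pols_mult) auto
    moreover have "L0 = (\<lambda>x. \<Sum>b<p'. (x (p + b) * F b x - 1) * (x (p + b) * F b x - 1))"
      by (intro ext) (simp add: L0_def power2_eq_square)
    moreover have "D = (1 + w * d) + (1 + w * d)" by (simp add: D_def)
    ultimately show ?thesis by (simp only:)
  qed
  have "\<forall>i. \<exists>g\<in>pols q D. \<forall>x. ((\<lambda>s. L0 (x(i := s))) has_real_derivative g x) (at (x i))"
    using pols_deriv[OF L0] by blast
  then obtain G where G: "\<And>i. G i \<in> pols q D"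
    "\<And>i x. ((\<lambda>s. L0 (x(i := s))) has_real_derivative G i x) (at (x i))" by metis
  \<comment> \<open>Filling the extra coordinates with the inverses of the block products makes
    \<open>L0 (ext x) = 0\<close> for \<open>x\<close> in \<open>X\<close>.\<close>
  define ext where "ext x = (\<lambda>i. if i < p then x i else if i < q then inverse (F (i - p) x) else 0)" for x
  \<comment> \<open>The exponent \<open>D + 2\<close> is even, so the penalty is nonnegative and
    grows in every direction of the first \<open>q\<close> coordinates; its derivative has the power
    \<open>D + 1\<close>, above the degree of the gradient of \<open>L0\<close>.\<close>
  define pen where "pen x = (\<Sum>i<q. x i ^ (D + 2))" for x :: "nat \<Rightarrow> real"
  have even: "even (D + 2)" by (simp add: D_def)
  have ev: "0 \<le> z ^ (D + 2)" for z :: real using even by (rule zero_le_even_power)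
  have pen_ge: "x i ^ (D + 2) \<le> pen x" if "i < q" for x i
    unfolding pen_def using that by (intro member_le_sum[where f = "\<lambda>i. x i ^ (D + 2)"] ev) auto
  obtain \<epsilon> where \<epsilon>: "\<epsilon> > 0" "\<And>x. x \<in> X \<Longrightarrow> \<epsilon> * pen (ext x) < 1"
  proof -
    define m where "m = Max (insert 0 ((\<lambda>x. pen (ext x)) ` X))"
    have "0 \<le> m" unfolding m_def using X by (intro Max_ge) auto
    moreover have "pen (ext x) \<le> m" if "x \<in> X" for x unfolding m_def using X that by (intro Max_ge) auto
    ultimately have "1 / (m + 1) * pen (ext x) < 1" if "x \<in> X" for x
      using that by (fastforce simp: divide_simps)
    then show ?thesis using \<open>0 \<le> m\<close> by (intro that[of "1 / (m + 1)"]) auto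
  qed
  define L where "L x = L0 x + \<epsilon> * pen x" for x
  \<comment> \<open>A coordinate of size at least \<open>R\<close> forces \<open>L\<close> to be at
    least 1, so the region \<open>L < 1\<close> lies strictly inside the box. The 1 in the maximum
    gives \<open>R \<le> R ^ (D + 2)\<close>.\<close>
  define R where "R = max 1 (1 / \<epsilon>)"
  have big: "1 \<le> L x" if "i < q" "R \<le> \<bar>x i\<bar>" for x i
  proof -
    have "1 / \<epsilon> \<le> R" "1 \<le> R" by (auto simp: R_def)
    have "1 = \<epsilon> * (1 / \<epsilon>)" using \<epsilon> by simp
    also have "\<dots> \<le> \<epsilon> * R" using \<open>1 / \<epsilon> \<le> R\<close> \<epsilon> by (intro mult_left_mono) auto
    finally have "1 \<le> \<epsilon> * R" .
    have "R \<le> R ^ (D + 2)" using \<open>1 \<le> R\<close> by (intro self_le_power) auto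
    also have "\<dots> \<le> \<bar>x i\<bar> ^ (D + 2)" using that \<open>1 \<le> R\<close> by (intro power_mono) auto
    also have "\<dots> = x i ^ (D + 2)" using even by (simp only: power_even_abs)
    also have "\<dots> \<le> pen x" by (rule pen_ge[OF that(1)])
    finally have "\<epsilon> * R \<le> \<epsilon> * pen x" using \<epsilon> by (intro mult_left_mono) auto
    then have "1 \<le> \<epsilon> * pen x" using \<open>1 \<le> \<epsilon> * R\<close> by linarith
    moreover have "0 \<le> L0 x" unfolding L0_def by (intro sum_nonneg) auto
    ultimately show ?thesis by (simp add: L_def)
  qed
  have nz: "f x + \<delta> \<noteq> 0" if "x \<in> X" "b < p'" "f \<in> Fs b" for x b f
    using \<delta>(1) \<delta>(2)[OF that] by (cases "f x < 0") auto
  have ext_f: "f (ext x) = f x" if "f \<in> pols p d'" for f d' x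
    using that by (rule pols_cong) (simp add: ext_def)
  have L_ext: "L (ext x) < 1" if "x \<in> X" for x
  proof -
    have "F b x \<noteq> 0" if "b < p'" for b
      unfolding F_def using nz[OF \<open>x \<in> X\<close> that] Fs(1)[OF that] by (simp add: prod_zero_iff)
    then have "ext x (p + b) * F b (ext x) = 1" if "b < p'" for b
      using that ext_f[OF F[OF that]] by (simp add: ext_def q_def)
    then have "L0 (ext x) = 0" by (simp add: L0_def)
    then show ?thesis using \<epsilon>(2)[OF that] by (simp add: L_def)
  qed
  have cont: "continuous_on UNIV L" "\<And>b f. b < p' \<Longrightarrow> f \<in> Fs b \<Longrightarrow> continuous_on UNIV f"
  proof -
    show "continuous_on UNIV f" if "b < p'" "f \<in> Fs b" for b f
      using fq[OF that] by (rule pols_continuous)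
    show "continuous_on UNIV L"
      unfolding L_def pen_def
      by (intro continuous_intros pols_continuous[OF L0] continuous_on_product_coordinates)
  qed
  \<comment> \<open>\<open>u\<close> minimises \<open>L\<close> over the closed sign cell of
    \<open>x\<close> inside the box. Since \<open>L (ext x) < 1\<close>, also
    \<open>L u < 1\<close>, which keeps \<open>u\<close> off the boundary of the box and off the
    zeros of the shifted polynomials; hence the partial derivatives in the first \<open>q\<close>
    coordinates vanish.\<close>
  have crit: "\<exists>u. (\<forall>i\<ge>q. u i = 0) \<and> (\<forall>b<p'. \<forall>f\<in>Fs b. (f u + \<delta>) * (f x + \<delta>) > 0) \<and>
      (\<forall>i<q. u i ^ (D + 1) = - 1 / (\<epsilon> * real (D + 2)) * G i u)" if x: "x \<in> X" for x
  proof -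
    define B where "B = {u :: nat \<Rightarrow> real. (\<forall>i<q. \<bar>u i\<bar> \<le> R) \<and> (\<forall>i\<ge>q. u i = 0)}"
    \<comment> \<open>Weak inequalities make the cell closed, as compactness requires; they turn out
      strict at the minimiser.\<close>
    define C where "C = (\<Inter>b<p'. \<Inter>f\<in>Fs b. {u. 0 \<le> (f u + \<delta>) * (f x + \<delta>)})"
    have "compact B" unfolding B_def by (rule compact_box)
    moreover have "closed C"
      unfolding C_def using cont(2) by (intro closed_INT ballI closed_Collect_le continuous_intros) auto
    ultimately have "compact (C \<inter> B)" by (simp add: closed_Int_compact)
    moreover have inC: "ext x \<in> C"
    proof -
      have "0 \<le> (f (ext x) + \<delta>) * (f x + \<delta>)" if "b < p'" "f \<in> Fs b" for b f
      proof -
        have "f (ext x) = f x" using that Fs(3)[OF that(1)] by (intro ext_f[of f d]) auto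
        then show ?thesis by simp
      qed
      then show ?thesis by (auto simp: C_def)
    qed
    moreover have "ext x \<in> B"
    proof -
      have "\<bar>ext x i\<bar> \<le> R" if "i < q" for i
        using big[OF that, of "ext x"] L_ext[OF x] by linarith
      then show ?thesis by (auto simp: B_def ext_def q_def)
    qed
    ultimately obtain u where u: "u \<in> C" "u \<in> B" and umin: "\<And>v. v \<in> C \<Longrightarrow> v \<in> B \<Longrightarrow> L u \<le> L v"
      using continuous_attains_inf[of "C \<inter> B" L] cont(1) by (metis IntE IntI continuous_on_subset empty_iff subset_UNIV)
    have Lu: "L u < 1" using umin[OF inC \<open>ext x \<in> B\<close>] L_ext[OF x] by simp
    have uR: "\<bar>u i\<bar> < R" if "i < q" for i using big[OF that, of u] Lu by linarith
    \<comment> \<open>If \<open>F b u\<close> were 0, the summand of \<open>L0\<close> for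
      \<open>b\<close> alone would be 1, against \<open>L u < 1\<close>.\<close>
    have Fu: "F b u \<noteq> 0" if "b < p'" for b
    proof
      assume 0: "F b u = 0"
      have "(u (p + b) * F b u - 1) ^ 2 \<le> L0 u"
        unfolding L0_def using that by (intro member_le_sum) auto
      moreover have "0 \<le> pen u" unfolding pen_def by (intro sum_nonneg ev)
      ultimately show False using 0 Lu \<epsilon>(1) by (simp add: L_def) (smt (verit) mult_nonneg_nonneg)
    qed
    have str: "(f u + \<delta>) * (f x + \<delta>) > 0" if "b < p'" "f \<in> Fs b" for b f
    proof -
      have "f u + \<delta> \<noteq> 0" using Fu[OF that(1)] that Fs(1)[OF that(1)] by (auto simp: F_def prod_zero_iff)
      moreover have "0 \<le> (f u + \<delta>) * (f x + \<delta>)" using u that by (auto simp: C_def)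
      ultimately show ?thesis using nz[OF x that] by (simp add: order_less_le)
    qed
    have der: "u i ^ (D + 1) = - 1 / (\<epsilon> * real (D + 2)) * G i u" if i: "i < q" for i
    proof -
      have pend: "((\<lambda>s. pen (u(i := s))) has_real_derivative real (D + 2) * u i ^ (D + 1)) (at (u i))"
      proof -
        have "pen (u(i := s)) = s ^ (D + 2) + (\<Sum>j\<in>{..<q}-{i}. u j ^ (D + 2))" for s
          unfolding pen_def using i by (subst sum.remove[of _ i]) (auto intro!: sum.cong)
        moreover have "((\<lambda>s. s ^ (D + 2) + (\<Sum>j\<in>{..<q}-{i}. u j ^ (D + 2)))
            has_real_derivative real (D + 2) * u i ^ (D + 1)) (at (u i))"
          by (rule DERIV_cong[OF DERIV_add[OF DERIV_pow DERIV_const]]) simp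
        ultimately show ?thesis by (simp only:)
      qed
      have d: "((\<lambda>s. L (u(i := s))) has_real_derivative G i u + \<epsilon> * (real (D + 2) * u i ^ (D + 1))) (at (u i))"
        unfolding L_def by (intro derivative_intros DERIV_cmult G pend)
      \<comment> \<open>The strict signs and the strict bound by \<open>R\<close> survive a small
        change of one coordinate, so the constrained minimum is a local minimum in that
        coordinate.\<close>
      have "\<forall>\<^sub>F s in at (u i). u(i := s) \<in> C \<inter> B"
      proof -
        have c: "isCont (\<lambda>s. f (u(i := s))) (u i)" if "b < p'" "f \<in> Fs b" for b f
          using pols_deriv[OF fq[OF that], of i] DERIV_isCont by blast
        have "\<forall>\<^sub>F s in at (u i). 0 < (f (u(i := s)) + \<delta>) * (f x + \<delta>)" if "b < p'" "f \<in> Fs b" for b f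
        proof -
          have "((\<lambda>s. (f (u(i := s)) + \<delta>) * (f x + \<delta>)) \<longlongrightarrow> (f u + \<delta>) * (f x + \<delta>)) (at (u i))"
            using c[OF that] by (intro tendsto_intros) (simp add: isCont_def)
          then show ?thesis using str[OF that] by (rule order_tendstoD(1))
        qed
        then have "\<forall>\<^sub>F s in at (u i). \<forall>b\<in>{..<p'}. \<forall>f\<in>Fs b. 0 < (f (u(i := s)) + \<delta>) * (f x + \<delta>)"
          using Fs(1) by (intro eventually_ball_finite ballI) auto
        moreover have "\<forall>\<^sub>F s in at (u i). \<bar>s\<bar> < R"
          by (rule order_tendstoD(2)[OF tendsto_rabs[OF tendsto_ident_at] uR[OF i]])
        ultimately show ?thesis
        proof eventually_elim
          case (elim s)
          then show ?case using u(2) i by (fastforce simp: C_def B_def intro: less_imp_le)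
        qed
      qed
      then have "\<forall>\<^sub>F s in at (u i). L u \<le> L (u(i := s))"
        by (rule eventually_mono) (use umin in auto)
      then obtain e where e: "e > 0" "\<And>s. s \<noteq> u i \<Longrightarrow> dist s (u i) < e \<Longrightarrow> L u \<le> L (u(i := s))"
        by (auto simp: eventually_at)
      have "G i u + \<epsilon> * (real (D + 2) * u i ^ (D + 1)) = 0"
      proof (rule DERIV_local_min[OF d e(1)], intro allI impI)
        fix s assume "\<bar>u i - s\<bar> < e"
        then show "L (u(i := u i)) \<le> L (u(i := s))"
          using e(2)[of s] by (cases "s = u i") (auto simp: dist_real_def abs_minus_commute)
      qed
      then have "\<epsilon> * real (D + 2) * u i ^ (D + 1) = - G i u"
        unfolding mult.assoc by linarith
      moreover have "z = - 1 / a * g" if "a * z = - g" "a \<noteq> 0" for a z g :: real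
      proof -
        have "g = - (a * z)" using that(1) by linarith
        then show ?thesis using that(2) by simp
      qed
      ultimately show ?thesis using \<epsilon>(1) by simp
    qed
    show ?thesis using u(2) str der by (auto simp: B_def)
  qed
  then obtain U where U: "\<And>x i. x \<in> X \<Longrightarrow> i \<ge> q \<Longrightarrow> U x i = 0"
    "\<And>x b f. x \<in> X \<Longrightarrow> b < p' \<Longrightarrow> f \<in> Fs b \<Longrightarrow> (f (U x) + \<delta>) * (f x + \<delta>) > 0"
    "\<And>x i. x \<in> X \<Longrightarrow> i < q \<Longrightarrow> U x i ^ (D + 1) = - 1 / (\<epsilon> * real (D + 2)) * G i (U x)"
    by metis
  \<comment> \<open>\<open>U x\<close> keeps the strict shifted signs of \<open>x\<close>, and these
    determine the weak signs that separate the points of \<open>X\<close>.\<close>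
  have "inj_on U X"
  proof (rule inj_onI, rule ccontr)
    fix x y assume xy: "x \<in> X" "y \<in> X" "U x = U y" "x \<noteq> y"
    then obtain b f where bf: "b < p'" "f \<in> Fs b" "(0 \<le> f x) \<noteq> (0 \<le> f y)" using X(2) by blast
    have s: "0 \<le> f z \<longleftrightarrow> 0 < f (U z) + \<delta>" if "z \<in> X" for z
    proof (cases "0 \<le> f z")
      case True
      then have "f z + \<delta> > 0" using \<delta>(1) by simp
      then show ?thesis using U(2)[OF that bf(1,2)] True by (simp add: zero_less_mult_iff)
    next
      case False
      then have "f z + \<delta> < 0" using \<delta>(2)[OF that bf(1,2)] by simp
      then show ?thesis using U(2)[OF that bf(1,2)] False by (simp add: zero_less_mult_iff)
    qed
    show False using bf(3) s[OF xy(1)] s[OF xy(2)] xy(3) by simp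
  qed
  then have "card X = card (U ` X)" by (simp add: card_image)
  \<comment> \<open>The critical-point equations express the power \<open>D + 1\<close> of each
    coordinate by a polynomial of degree at most \<open>D\<close>.\<close>
  also have "\<dots> \<le> (D + 1) ^ q"
  proof (rule card_zeros_le[where h = "\<lambda>i u. - 1 / (\<epsilon> * real (D + 2)) * G i u" and D = D])
    show "(\<lambda>u. - 1 / (\<epsilon> * real (D + 2)) * G i u) \<in> pols q D" for i
      by (rule pols_scale[OF G(1)])
    show "D < D + 1" by simp
  qed (use X(1) U(1,3) in blast)+
  also have "D + 1 = 2 * w * d + 3" by (simp add: D_def)
  finally show ?thesis by (simp only: q_def)
qed

subsection \<open>Feasibility of linear systems\<close>

definition feas :: "nat \<Rightarrow> nat \<Rightarrow> (nat \<Rightarrow> nat \<Rightarrow> real) \<Rightarrow> (nat \<Rightarrow> real) \<Rightarrow> bool" where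
  "feas k M a \<beta> \<longleftrightarrow> (\<exists>y. \<forall>s<M. (\<Sum>j<k. a s j * y j) \<le> \<beta> s)"

text \<open>Either the last variable can be 0, or some row \<open>r\<close> containing it can be
  made tight and solved for it. Multiplying the substituted rows by \<open>a r k ^ 2\<close> clears
  the denominator, preserves the inequalities and keeps the coefficients polynomial.\<close>

lemma feas_Suc:
  "feas (Suc k) M a \<beta> \<longleftrightarrow> feas k M a \<beta> \<or>
     (\<exists>r<M. a r k \<noteq> 0 \<and> feas k M (\<lambda>s j. a r k ^ 2 * a s j - a r k * a s k * a r j)
                                  (\<lambda>s. a r k ^ 2 * \<beta> s - a r k * a s k * \<beta> r))"
  (is "_ \<longleftrightarrow> _ \<or> (\<exists>r<M. a r k \<noteq> 0 \<and> feas k M (?a r) (?\<beta> r))")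
proof -
  have lin: "(\<Sum>j<k. ?a r s j * y j) = a r k ^ 2 * (\<Sum>j<k. a s j * y j) - a r k * a s k * (\<Sum>j<k. a r j * y j)" for r s y
    by (simp add: sum_subtractf sum_distrib_left algebra_simps)
  show ?thesis
  proof (intro iffI; (elim disjE exE conjE)?)
    assume "feas (Suc k) M a \<beta>"
    then obtain y where y: "\<And>s. s < M \<Longrightarrow> (\<Sum>j<k. a s j * y j) + a s k * y k \<le> \<beta> s"
      by (auto simp: feas_def)
    show "feas k M a \<beta> \<or> (\<exists>r<M. a r k \<noteq> 0 \<and> feas k M (?a r) (?\<beta> r))"
    proof (cases "\<forall>s<M. a s k = 0")
      case True
      then have "feas k M a \<beta>" unfolding feas_def using y by fastforce
      then show ?thesis ..
    next
      case False
      define R where "R s = \<beta> s - (\<Sum>j<k. a s j * y j) - a s k * y k" for s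
      have R: "R s \<ge> 0" if "s < M" for s using y[OF that] by (simp add: R_def)
      let ?N = "{s. s < M \<and> a s k \<noteq> 0}"
      have N: "finite ?N" "?N \<noteq> {}" using False by auto
      \<comment> \<open>With \<open>R s\<close> the slack of row \<open>s\<close>,
        \<open>R s / a s k\<close> is the shift of the last coordinate that makes row
        \<open>s\<close> tight. The shift of least absolute value, in whichever direction, violates
        no other row.\<close>
      obtain r where r: "r < M" "a r k \<noteq> 0"
        and rmin: "\<And>s. s < M \<Longrightarrow> a s k \<noteq> 0 \<Longrightarrow> \<bar>R r / a r k\<bar> \<le> \<bar>R s / a s k\<bar>"
        using arg_min_if_finite[OF N, of "\<lambda>s. \<bar>R s / a s k\<bar>"]
          arg_min_least[OF N, of _ "\<lambda>s. \<bar>R s / a s k\<bar>"] by blast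
      define \<theta> where "\<theta> = R r / a r k"
      have step: "a s k * \<theta> \<le> R s" if "s < M" for s
      proof (cases "a s k = 0")
        case False
        have "a s k * \<theta> \<le> \<bar>a s k\<bar> * \<bar>\<theta>\<bar>" by (simp add: abs_mult[symmetric])
        also have "\<dots> \<le> \<bar>a s k\<bar> * \<bar>R s / a s k\<bar>"
          using rmin[OF that False] by (intro mult_left_mono) (auto simp: \<theta>_def)
        also have "\<dots> = R s" using False R[OF that] by simp
        finally show ?thesis .
      qed (use R[OF that] in simp)
      have tight: "(\<Sum>j<k. a r j * y j) = \<beta> r - a r k * (y k + \<theta>)"
      proof -
        have "a r k * \<theta> = R r" using r by (simp add: \<theta>_def)
        then show ?thesis by (simp add: R_def distrib_left)
      qed
      have "(\<Sum>j<k. ?a r s j * y j) \<le> ?\<beta> r s" if "s < M" for s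
      proof -
        have "(\<Sum>j<k. a s j * y j) + a s k * (y k + \<theta>) \<le> \<beta> s"
          using step[OF that] by (simp add: R_def algebra_simps)
        then have "a r k ^ 2 * ((\<Sum>j<k. a s j * y j) + a s k * (y k + \<theta>)) \<le> a r k ^ 2 * \<beta> s"
          by (intro mult_left_mono) auto
        then show ?thesis unfolding lin tight by (simp add: algebra_simps power2_eq_square)
      qed
      then have "feas k M (?a r) (?\<beta> r)" unfolding feas_def by blast
      then show ?thesis using r by blast
    qed
  next
    assume "feas k M a \<beta>"
    then obtain y where y: "\<And>s. s < M \<Longrightarrow> (\<Sum>j<k. a s j * y j) \<le> \<beta> s"
      by (auto simp: feas_def)
    then show "feas (Suc k) M a \<beta>" unfolding feas_def
      by (intro exI[of _ "y(k := 0)"]) auto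
  next
    fix r assume r: "r < M" "a r k \<noteq> 0" and "feas k M (?a r) (?\<beta> r)"
    then obtain y where y: "\<And>s. s < M \<Longrightarrow> (\<Sum>j<k. ?a r s j * y j) \<le> ?\<beta> r s"
      by (auto simp: feas_def)
    define t where "t = (\<beta> r - (\<Sum>j<k. a r j * y j)) / a r k"
    have tight: "(\<Sum>j<k. a r j * y j) = \<beta> r - a r k * t" using r by (simp add: t_def)
    have "(\<Sum>j<k. a s j * y j) + a s k * t \<le> \<beta> s" if "s < M" for s
    proof -
      have "a r k ^ 2 * ((\<Sum>j<k. a s j * y j) + a s k * t) \<le> a r k ^ 2 * \<beta> s"
        using y[OF that] unfolding lin tight by (simp add: algebra_simps power2_eq_square)
      then show ?thesis using r by (simp add: mult_le_cancel_left)
    qed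
    then show "feas (Suc k) M a \<beta>" unfolding feas_def
      by (intro exI[of _ "y(k := t)"]) auto
  qed
qed

text \<open>Each elimination triples the degree bound and leaves \<open>M + 1\<close> systems.
  Bounding \<open>Suc (card G)\<close> rather than \<open>card G\<close> leaves room for the
  polynomial that tests each pivot, so the count grows by a factor of exactly
  \<open>M + 1\<close>.\<close>

lemma feas_sign_determined:
  assumes "\<And>s j. s < M \<Longrightarrow> j < k \<Longrightarrow> a s j \<in> pols p d" "\<And>s. s < M \<Longrightarrow> \<beta> s \<in> pols p d"
  shows "\<exists>G. finite G \<and> Suc (card G) \<le> (M + 1) ^ (k + 1) \<and> G \<subseteq> pols p (3 ^ k * d) \<and>
    (\<forall>x x'. (\<forall>g\<in>G. 0 \<le> g x \<longleftrightarrow> 0 \<le> g x') \<longrightarrow>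
       feas k M (\<lambda>s j. a s j x) (\<lambda>s. \<beta> s x) = feas k M (\<lambda>s j. a s j x') (\<lambda>s. \<beta> s x'))"
  using assms
proof (induction k arbitrary: a \<beta> d)
  case 0
  show ?case
  proof (intro exI[of _ "\<beta> ` {..<M}"] conjI)
    show "Suc (card (\<beta> ` {..<M})) \<le> (M + 1) ^ (0 + 1)"
      using card_image_le[of "{..<M}" \<beta>] by simp
  qed (use 0 in \<open>auto simp: feas_def\<close>)
next
  case (Suc k)
  let ?a = "\<lambda>r s j x. a r k x ^ 2 * a s j x - a r k x * a s k x * a r j x"
  let ?\<beta> = "\<lambda>r s x. a r k x ^ 2 * \<beta> s x - a r k x * a s k x * \<beta> r x"
  let ?Q = "\<lambda>G a \<beta>. \<forall>x x'. (\<forall>g\<in>G. 0 \<le> g x \<longleftrightarrow> 0 \<le> g x') \<longrightarrow>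
       feas k M (\<lambda>s j. a s j x) (\<lambda>s. \<beta> s x) = feas k M (\<lambda>s j. a s j x') (\<lambda>s. \<beta> s x')"
  obtain G0 where G0: "finite G0" "Suc (card G0) \<le> (M + 1) ^ (k + 1)" "G0 \<subseteq> pols p (3 ^ k * d)"
    "?Q G0 a \<beta>"
    using Suc.IH[of a d \<beta>] Suc.prems by auto
  have cubic: "(\<lambda>x. f x ^ 2 * g x - f x * h x * l x) \<in> pols p (3 * d)"
    if "f \<in> pols p d" "g \<in> pols p d" "h \<in> pols p d" "l \<in> pols p d" for f g h l
  proof -
    have "(\<lambda>x. f x * f x * g x - f x * h x * l x) \<in> pols p (d + d + d)"
      by (intro pols_diff pols_mult that)
    moreover have "d + d + d = 3 * d" by simp
    ultimately show ?thesis by (simp only: power2_eq_square)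
  qed
  define P where "P r G \<longleftrightarrow> finite G \<and> Suc (card G) \<le> (M + 1) ^ (k + 1) \<and>
    G \<subseteq> pols p (3 ^ k * (3 * d)) \<and> ?Q G (?a r) (?\<beta> r)" for r G
  have "\<exists>G. P r G" if "r < M" for r
    unfolding P_def by (rule Suc.IH) (use that in \<open>auto intro!: cubic Suc.prems\<close>)
  then obtain G where P: "\<And>r. r < M \<Longrightarrow> P r (G r)" by metis
  have G: "finite (G r)" "Suc (card (G r)) \<le> (M + 1) ^ (k + 1)"
    "G r \<subseteq> pols p (3 ^ k * (3 * d))" "?Q (G r) (?a r) (?\<beta> r)" if "r < M" for r
    using P[OF that] unfolding P_def by - (elim conjE, assumption)+
  \<comment> \<open>The negated square is nonnegative exactly where the pivot vanishes, so a single
    weak sign decides whether the pivot is nonzero.\<close>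
  define piv where "piv r = (\<lambda>x. - (a r k x * a r k x))" for r
  have piv: "piv r \<in> pols p (3 ^ Suc k * d)" if "r < M" for r
  proof -
    have "(\<lambda>x. 0 - a r k x * a r k x) \<in> pols p (d + d)"
      by (intro pols_diff pols_zero pols_mult Suc.prems that) auto
    moreover have "d + d \<le> 3 ^ Suc k * d"
    proof -
      have "(1::nat) \<le> 3 ^ k" by simp
      then have "(2::nat) \<le> 3 ^ Suc k" unfolding power_Suc by linarith
      then have "2 * d \<le> 3 ^ Suc k * d" by (rule mult_right_mono) simp
      then show ?thesis by (simp only: mult_2)
    qed
    ultimately show ?thesis using pols_mono unfolding piv_def by fastforce
  qed
  define H where "H = G0 \<union> (\<Union>r<M. insert (piv r) (G r))"
  show ?case
  proof (intro exI[of _ H] conjI allI impI)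
    show "finite H" using G0 G by (auto simp: H_def)
    have "card H \<le> card G0 + card (\<Union>r<M. insert (piv r) (G r))"
      unfolding H_def by (rule card_Un_le)
    also have "card (\<Union>r<M. insert (piv r) (G r)) \<le> (\<Sum>r<M. card (insert (piv r) (G r)))"
      by (rule card_UN_le) simp
    also have "\<dots> \<le> (\<Sum>r<M. (M + 1) ^ (k + 1))"
    proof (rule sum_mono)
      fix r assume "r \<in> {..<M}"
      then show "card (insert (piv r) (G r)) \<le> (M + 1) ^ (k + 1)"
        using G(1,2)[of r] by (auto simp: card_insert_if simp del: power_Suc)
    qed
    finally show "Suc (card H) \<le> (M + 1) ^ (Suc k + 1)" using G0(2) by simp
    have "G0 \<subseteq> pols p (3 ^ Suc k * d)"
      using G0(3) pols_mono[of "3 ^ k * d" "3 ^ Suc k * d" p] by auto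
    then show "H \<subseteq> pols p (3 ^ Suc k * d)"
      using G(3) piv by (fastforce simp: H_def algebra_simps)
    fix x x' assume *: "\<forall>g\<in>H. 0 \<le> g x \<longleftrightarrow> 0 \<le> g x'"
    have 0: "feas k M (\<lambda>s j. a s j x) (\<lambda>s. \<beta> s x) = feas k M (\<lambda>s j. a s j x') (\<lambda>s. \<beta> s x')"
      using G0(4) * by (auto simp: H_def)
    have 1: "a r k x \<noteq> 0 \<longleftrightarrow> a r k x' \<noteq> 0" if "r < M" for r
    proof -
      have sq: "(0 \<le> - (z * z)) = (z = 0)" for z :: real
        by (metis linorder_not_less mult_zero_left neg_0_le_iff_le not_real_square_gt_zero order_refl)
      have "0 \<le> piv r x \<longleftrightarrow> 0 \<le> piv r x'" using * that by (auto simp: H_def)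
      then show ?thesis by (simp only: piv_def sq)
    qed
    have 2: "feas k M (\<lambda>s j. ?a r s j x) (\<lambda>s. ?\<beta> r s x) = feas k M (\<lambda>s j. ?a r s j x') (\<lambda>s. ?\<beta> r s x')"
      if "r < M" for r
    proof -
      have "\<forall>g\<in>G r. 0 \<le> g x \<longleftrightarrow> 0 \<le> g x'" using * that by (auto simp: H_def)
      then show ?thesis using G(4)[OF that] by blast
    qed
    show "feas (Suc k) M (\<lambda>s j. a s j x) (\<lambda>s. \<beta> s x) = feas (Suc k) M (\<lambda>s j. a s j x') (\<lambda>s. \<beta> s x')"
      unfolding feas_Suc using 0 1 2 by blast
  qed
qed

subsection \<open>Shattering by projected LPs\<close>

text \<open>An existential form of reaching a threshold: it speaks of feasible points instead of the
  supremum and is therefore a linear feasibility problem in \<open>y\<close>.\<close>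

definition lp_reaches :: "nat \<Rightarrow> nat \<Rightarrow> nat \<Rightarrow> (nat \<Rightarrow> nat \<Rightarrow> real) \<Rightarrow> lp_inst \<Rightarrow> real \<Rightarrow> bool" where
  "lp_reaches n k m P \<pi> \<tau> \<longleftrightarrow>
     (\<exists>y. lp_feasible n m \<pi> (mat_vec k P y) \<and> \<tau> \<le> lp_obj n \<pi> (mat_vec k P y))"

text \<open>Row-major order: the entry in row \<open>i\<close> and column \<open>j < k\<close>
  becomes the variable \<open>i * k + j\<close>.\<close>

definition flatten :: "nat \<Rightarrow> (nat \<Rightarrow> nat \<Rightarrow> real) \<Rightarrow> nat \<Rightarrow> real" where
  "flatten k P i = P (i div k) (i mod k)"

lemma lp_reaches_sign_determined:
  "\<exists>G. finite G \<and> card G \<le> (m + 2) ^ (k + 1) \<and> G \<subseteq> pols (n * k) (3 ^ k) \<and>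
    (\<forall>P P'. (\<forall>g\<in>G. 0 \<le> g (flatten k P) \<longleftrightarrow> 0 \<le> g (flatten k P')) \<longrightarrow>
       lp_reaches n k m P \<pi> \<tau> = lp_reaches n k m P' \<pi> \<tau>)"
proof -
  obtain c A b where \<pi>: "\<pi> = (c, A, b)" by (cases \<pi>)
  \<comment> \<open>Row \<open>m\<close> states the threshold condition with reversed sign, so there
    are \<open>m + 1\<close> constraints. Their coefficients are linear in the entries of
    \<open>P\<close>, and elimination starts at degree 1.\<close>
  define row where "row s = (if s < m then A s else (\<lambda>i. - c i))" for s
  define a where "a s j x = (\<Sum>i<n. row s i * x (i * k + j))" for s j and x :: "nat \<Rightarrow> real"
  define \<beta> where "\<beta> s x = (if s < m then b s else - \<tau>)" for s and x :: "nat \<Rightarrow> real"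
  have a: "a s j \<in> pols (n * k) 1" if "j < k" for s j
  proof -
    have "i * k + j < n * k" if "i < n" for i
    proof -
      have "i * k + j < Suc i * k" using \<open>j < k\<close> by simp
      also have "\<dots> \<le> n * k" using that by (intro mult_right_mono) auto
      finally show ?thesis .
    qed
    then show ?thesis unfolding a_def by (intro pols_sum pols_scale pols_var) auto
  qed
  have \<beta>: "\<beta> s \<in> pols (n * k) 1" for s unfolding \<beta>_def by (rule pols_const)
  have reach: "lp_reaches n k m P \<pi> \<tau> \<longleftrightarrow>
      feas k (Suc m) (\<lambda>s j. a s j (flatten k P)) (\<lambda>s. \<beta> s (flatten k P))" for P
  proof -
    have "(\<Sum>j<k. a s j (flatten k P) * y j) = (\<Sum>i<n. row s i * mat_vec k P y i)" for s y
    proof -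
      have "(\<Sum>j<k. a s j (flatten k P) * y j) = (\<Sum>j<k. \<Sum>i<n. row s i * (P i j * y j))"
        unfolding a_def flatten_def sum_distrib_right by (intro sum.cong) auto
      also have "\<dots> = (\<Sum>i<n. \<Sum>j<k. row s i * (P i j * y j))" by (rule sum.swap)
      finally show ?thesis by (simp add: mat_vec_def sum_distrib_left)
    qed
    then show ?thesis
      by (auto simp: feas_def lp_reaches_def lp_feasible_def lp_obj_def \<pi> \<beta>_def row_def less_Suc_eq sum_negf)
  qed
  have "\<exists>G. finite G \<and> Suc (card G) \<le> (Suc m + 1) ^ (k + 1) \<and> G \<subseteq> pols (n * k) (3 ^ k * 1) \<and>
    (\<forall>x x'. (\<forall>g\<in>G. 0 \<le> g x \<longleftrightarrow> 0 \<le> g x') \<longrightarrow>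
       feas k (Suc m) (\<lambda>s j. a s j x) (\<lambda>s. \<beta> s x) = feas k (Suc m) (\<lambda>s j. a s j x') (\<lambda>s. \<beta> s x'))"
    by (rule feas_sign_determined[OF a \<beta>])
  then obtain G where G: "finite G" "Suc (card G) \<le> (Suc m + 1) ^ (k + 1)" "G \<subseteq> pols (n * k) (3 ^ k * 1)"
    "\<And>x x'. \<forall>g\<in>G. 0 \<le> g x \<longleftrightarrow> 0 \<le> g x' \<Longrightarrow>
       feas k (Suc m) (\<lambda>s j. a s j x) (\<lambda>s. \<beta> s x) = feas k (Suc m) (\<lambda>s j. a s j x') (\<lambda>s. \<beta> s x')"
    by blast
  show ?thesis
    by (rule exI[of _ G]) (use G reach in auto)
qed

text \<open>The point \<open>y = 0\<close> makes the set of values nonempty and \<open>H\<close>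
  bounds it, so \<open>Sup\<close> is a genuine supremum. The case of equality with
  \<open>\<tau>\<close> is left out because it depends on attainment.\<close>

lemma proj_lp_val_reaches:
  assumes "lp_feasible n m \<pi> (\<lambda>_. 0)" "\<And>x. lp_feasible n m \<pi> x \<Longrightarrow> lp_obj n \<pi> x \<le> H"
  shows "\<tau> < proj_lp_val n k m P \<pi> \<Longrightarrow> lp_reaches n k m P \<pi> \<tau>"
    and "proj_lp_val n k m P \<pi> < \<tau> \<Longrightarrow> \<not> lp_reaches n k m P \<pi> \<tau>"
proof -
  let ?V = "{lp_obj n \<pi> (mat_vec k P y) | y. lp_feasible n m \<pi> (mat_vec k P y)}"
  have "mat_vec k P (\<lambda>_. 0) = (\<lambda>_. 0)" by (simp add: mat_vec_def)
  then have "lp_obj n \<pi> (mat_vec k P (\<lambda>_. 0)) \<in> ?V"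
    using assms(1) by (intro CollectI exI[of _ "\<lambda>_. 0"]) simp
  then have ne: "?V \<noteq> {}" by blast
  have bdd: "bdd_above ?V" using assms(2) by (auto intro!: bdd_aboveI[of _ H])
  show "lp_reaches n k m P \<pi> \<tau>" if "\<tau> < proj_lp_val n k m P \<pi>"
    using less_cSupD[OF ne, of \<tau>] that unfolding proj_lp_val_def lp_reaches_def by force
  show "\<not> lp_reaches n k m P \<pi> \<tau>" if "proj_lp_val n k m P \<pi> < \<tau>"
  proof
    assume "lp_reaches n k m P \<pi> \<tau>"
    then obtain y where y: "lp_feasible n m \<pi> (mat_vec k P y)" "\<tau> \<le> lp_obj n \<pi> (mat_vec k P y)"
      by (auto simp: lp_reaches_def)
    have "lp_obj n \<pi> (mat_vec k P y) \<le> Sup ?V" using y bdd by (intro cSup_upper) auto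
    then show False using y that by (simp add: proj_lp_val_def)
  qed
qed

lemma pshatters_subset:
  assumes "pshatters U S" "S' \<subseteq> S"
  shows "pshatters U S'"
proof -
  obtain t where t: "\<And>B. B \<subseteq> S \<Longrightarrow> \<exists>u\<in>U. \<forall>x\<in>S. (t x \<le> u x) = (x \<in> B)"
    using assms(1) by (auto simp: pshatters_def)
  show ?thesis unfolding pshatters_def
  proof (intro exI[of _ t] allI impI)
    fix B assume "B \<subseteq> S'"
    then show "\<exists>u\<in>U. \<forall>x\<in>S'. (t x \<le> u x) = (x \<in> B)" using t[of B] assms(2) by blast
  qed
qed

text \<open>Strict thresholds spare us from showing that the supremum is attained.\<close>

lemma pshatters_strict:
  assumes "pshatters U S" "finite S"
  shows "\<exists>\<tau> u. \<forall>B\<subseteq>S. u B \<in> U \<and> (\<forall>x\<in>B. \<tau> x < u B x) \<and> (\<forall>x\<in>S - B. u B x < \<tau> x)"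
proof -
  obtain t where t: "\<forall>B\<subseteq>S. \<exists>u\<in>U. \<forall>x\<in>S. (t x \<le> u x) = (x \<in> B)"
    using assms(1) unfolding pshatters_def by (elim exE)
  define u where "u B = (SOME v. v \<in> U \<and> (\<forall>x\<in>S. (t x \<le> v x) = (x \<in> B)))" for B
  have u: "u B \<in> U" "\<And>x. x \<in> S \<Longrightarrow> (t x \<le> u B x) = (x \<in> B)" if "B \<subseteq> S" for B
  proof -
    have "\<exists>v. v \<in> U \<and> (\<forall>x\<in>S. (t x \<le> v x) = (x \<in> B))" using t that by (simp add: Bex_def)
    from someI_ex[OF this] show "u B \<in> U" "\<And>x. x \<in> S \<Longrightarrow> (t x \<le> u B x) = (x \<in> B)"
      unfolding u_def by simp_all
  qed
  \<comment> \<open>For \<open>x\<close> in \<open>S\<close> these numbers all lie below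
    \<open>t x\<close>: the finitely many chosen values on the lower side, and
    \<open>t x - 1\<close>, which shows that the set is nonempty. The midpoint of their maximum and
    \<open>t x\<close> separates both sides strictly.\<close>
  define V where "V x = insert (t x - 1) ((\<lambda>B. u B x) ` {B. B \<subseteq> S \<and> x \<notin> B})" for x
  have fin: "finite (V x)" for x unfolding V_def using assms(2) by simp
  have Vt: "Max (V x) < t x" if "x \<in> S" for x
    using fin[of x] u(2)[OF _ that] by (subst Max_less_iff) (auto simp: V_def not_le[symmetric])
  define \<tau> where "\<tau> x = (Max (V x) + t x) / 2" for x
  show ?thesis
  proof (intro exI[of _ \<tau>] exI[of _ u] allI impI conjI ballI)
    fix B assume B: "B \<subseteq> S"
    show "u B \<in> U" using u(1)[OF B] .
    show "\<tau> x < u B x" if "x \<in> B" for x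
    proof -
      have "x \<in> S" using that B by blast
      then show ?thesis using u(2)[OF B, of x] Vt[of x] that by (simp add: \<tau>_def)
    qed
    show "u B x < \<tau> x" if "x \<in> S - B" for x
    proof -
      have "u B x \<in> V x" using that B by (auto simp: V_def)
      then have "u B x \<le> Max (V x)" using fin by (intro Max_ge)
      then show ?thesis using Vt[of x] that by (simp add: \<tau>_def)
    qed
  qed
qed

text \<open>The matrices realising the subsets of \<open>S\<close> have pairwise different sign
  patterns. The instances form \<open>n * k\<close> blocks of size \<open>r\<close>; the exponent on
  the right adds one auxiliary variable per block to the \<open>n * k\<close> matrix
  entries.\<close>

lemma shattered_power_le:
  assumes S: "finite S" "card S = n * k * r"
    and lp: "\<And>\<pi>. \<pi> \<in> S \<Longrightarrow> lp_feasible n m \<pi> (\<lambda>_. 0)"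
      "\<And>\<pi> x. \<pi> \<in> S \<Longrightarrow> lp_feasible n m \<pi> x \<Longrightarrow> lp_obj n \<pi> x \<le> H"
    and sh: "pshatters {proj_lp_val n k m P | P. True} S"
  shows "2 ^ (n * k * r) \<le> (2 * (r * (m + 2) ^ (k + 1)) * 3 ^ k + 3) ^ (n * k + n * k)"
proof -
  obtain \<tau> u where *: "\<forall>B\<subseteq>S. u B \<in> {proj_lp_val n k m P | P. True} \<and>
      (\<forall>x\<in>B. \<tau> x < u B x) \<and> (\<forall>x\<in>S - B. u B x < \<tau> x)"
    using pshatters_strict[OF sh S(1)] by (elim exE)
  have u: "u B \<in> {proj_lp_val n k m P | P. True}" "\<forall>x\<in>B. \<tau> x < u B x" "\<forall>x\<in>S - B. u B x < \<tau> x"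
    if "B \<subseteq> S" for B
    using * that by blast+
  have "\<forall>B. \<exists>P. B \<subseteq> S \<longrightarrow> u B = proj_lp_val n k m P" using u(1) by blast
  from choice[OF this] obtain P where P: "\<And>B. B \<subseteq> S \<Longrightarrow> u B = proj_lp_val n k m (P B)" by blast
  have reach: "lp_reaches n k m (P B) \<pi> (\<tau> \<pi>) \<longleftrightarrow> \<pi> \<in> B" if "B \<subseteq> S" "\<pi> \<in> S" for B \<pi>
  proof (cases "\<pi> \<in> B")
    case True
    then have "\<tau> \<pi> < proj_lp_val n k m (P B) \<pi>" using u(2)[OF that(1)] P[OF that(1)] by auto
    from proj_lp_val_reaches(1)[OF lp(1)[OF that(2)] lp(2)[OF that(2)] this] True show ?thesis by simp
  next
    case False
    then have "proj_lp_val n k m (P B) \<pi> < \<tau> \<pi>" using u(3)[OF that(1)] P[OF that(1)] that(2) by auto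
    from proj_lp_val_reaches(2)[OF lp(1)[OF that(2)] lp(2)[OF that(2)] this] False show ?thesis by simp
  qed
  define good where "good \<pi> G \<longleftrightarrow> finite G \<and> card G \<le> (m + 2) ^ (k + 1) \<and> G \<subseteq> pols (n * k) (3 ^ k) \<and>
    (\<forall>P P'. (\<forall>g\<in>G. 0 \<le> g (flatten k P) \<longleftrightarrow> 0 \<le> g (flatten k P')) \<longrightarrow>
       lp_reaches n k m P \<pi> (\<tau> \<pi>) = lp_reaches n k m P' \<pi> (\<tau> \<pi>))" for \<pi> G
  have "\<exists>G. good \<pi> G" for \<pi> unfolding good_def by (rule lp_reaches_sign_determined)
  then obtain G where "\<And>\<pi>. good \<pi> (G \<pi>)" by metis
  then have G: "\<And>\<pi>. finite (G \<pi>)" "\<And>\<pi>. card (G \<pi>) \<le> (m + 2) ^ (k + 1)" "\<And>\<pi>. G \<pi> \<subseteq> pols (n * k) (3 ^ k)"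
    "\<And>\<pi> P P'. (\<forall>g\<in>G \<pi>. 0 \<le> g (flatten k P) \<longleftrightarrow> 0 \<le> g (flatten k P')) \<Longrightarrow>
       lp_reaches n k m P \<pi> (\<tau> \<pi>) = lp_reaches n k m P' \<pi> (\<tau> \<pi>)"
    unfolding good_def by blast+
  define z where "z B = flatten k (P B)" for B
  have sep: "\<exists>\<pi>\<in>S. \<exists>g\<in>G \<pi>. (0 \<le> g (z B)) \<noteq> (0 \<le> g (z B'))" if "B \<subseteq> S" "B' \<subseteq> S" "B \<noteq> B'" for B B'
  proof -
    obtain \<pi> where \<pi>: "\<pi> \<in> S" "\<pi> \<in> B \<longleftrightarrow> \<pi> \<notin> B'" using \<open>B \<noteq> B'\<close> \<open>B \<subseteq> S\<close> \<open>B' \<subseteq> S\<close> by blast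
    then have "lp_reaches n k m (P B) \<pi> (\<tau> \<pi>) \<noteq> lp_reaches n k m (P B') \<pi> (\<tau> \<pi>)"
      using reach that by blast
    then show ?thesis using G(4)[of \<pi> "P B" "P B'"] \<pi>(1) unfolding z_def by blast
  qed
  have inj: "inj_on z (Pow S)" 
  proof (rule inj_onI, rule ccontr)
    fix B B' assume "B \<in> Pow S" "B' \<in> Pow S" "z B = z B'" "B \<noteq> B'"
    then show False using sep[of B B'] by simp
  qed
  obtain e where e: "bij_betw e {0..<n * k * r} S"
    using ex_bij_betw_nat_finite[OF S(1)] S(2) by auto
  define Fs where "Fs b = (\<Union>i\<in>{b * r..<b * r + r}. G (e i))" for b
  have "card (z ` Pow S) \<le> (2 * (r * (m + 2) ^ (k + 1)) * 3 ^ k + 3) ^ (n * k + n * k)"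
  proof (rule card_sign_patterns_le[where Fs = Fs])
    fix b
    show "finite (Fs b)" using G(1) by (simp add: Fs_def)
    have "card (Fs b) \<le> (\<Sum>i\<in>{b * r..<b * r + r}. card (G (e i)))"
      unfolding Fs_def by (rule card_UN_le) simp
    also have "\<dots> \<le> (\<Sum>i\<in>{b * r..<b * r + r}. (m + 2) ^ (k + 1))" by (intro sum_mono G)
    finally show "card (Fs b) \<le> r * (m + 2) ^ (k + 1)" by simp
    show "Fs b \<subseteq> pols (n * k) (3 ^ k)" unfolding Fs_def by (intro UN_least G(3))
  next
    show "finite (z ` Pow S)" using S(1) by simp
    fix x y assume "x \<in> z ` Pow S" "y \<in> z ` Pow S" "x \<noteq> y"
    then obtain B B' where B: "B \<subseteq> S" "B' \<subseteq> S" "B \<noteq> B'" "x = z B" "y = z B'" by auto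
    obtain \<pi> g where \<pi>: "\<pi> \<in> S" "g \<in> G \<pi>" "(0 \<le> g x) \<noteq> (0 \<le> g y)"
      using sep[OF B(1-3)] unfolding B(4,5) by blast
    obtain i where i: "i < n * k * r" "\<pi> = e i" using e \<pi>(1) by (auto simp: bij_betw_def)
    have "0 < r" using i(1) by (cases r) auto
    have "i div r < n * k" using i(1) \<open>0 < r\<close> by (simp add: div_less_iff_less_mult)
    moreover have "i \<in> {(i div r) * r..<(i div r) * r + r}"
      using dividend_less_div_times[OF \<open>0 < r\<close>, of i] by (simp add: add.commute)
    ultimately show "\<exists>b<n * k. \<exists>f\<in>Fs b. (0 \<le> f x) \<noteq> (0 \<le> f y)"
      using \<pi>(2,3) i(2) unfolding Fs_def by blast
  qed
  then show ?thesis using S inj by (simp add: card_image card_Pow)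
qed

text \<open>This is the negation of the bound for a shattered set after taking roots of order
  \<open>n * k\<close>; the square comes from the exponent \<open>n * k + n * k\<close>. With
  \<open>W\<close> the base, the constant 60 gives \<open>2 * ln W \<le> 5 / 8 * r\<close>, which is
  below \<open>2 / 3 * r\<close> and so below \<open>r * ln 2\<close>.\<close>

lemma threshold_growth:
  fixes m k r :: nat and \<Lambda> :: real
  assumes "0 < m" "0 < k" "1 \<le> \<Lambda>" "ln (real m) \<le> \<Lambda>" "60 * real k * \<Lambda> \<le> real r"
  shows "(2 * (r * (m + 2) ^ (k + 1)) * 3 ^ k + 3) ^ 2 < (2::nat) ^ r"
proof -
  have k: "1 \<le> real k" "1 \<le> real m" using assms by auto
  have "1 \<le> real k * \<Lambda>" using k(1) assms(3) mult_mono[of 1 "real k" 1 \<Lambda>] by simp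
  then have r: "60 \<le> real r" using assms(5) by linarith
  define W where "W = real (2 * (r * (m + 2) ^ (k + 1)) * 3 ^ k + 3)"
  have "1 \<le> real r * (real m + 2) ^ (k + 1) * 3 ^ k"
    using r k by (intro mult_ge1_I one_le_power) auto
  moreover have "W = 2 * (real r * (real m + 2) ^ (k + 1) * 3 ^ k) + 3"
    unfolding W_def by (simp only: of_nat_add of_nat_mult of_nat_power of_nat_numeral mult.assoc)
  ultimately have "W \<le> 5 * (real r * (real m + 2) ^ (k + 1) * 3 ^ k)" by linarith
  also have "\<dots> \<le> 5 * (real r * (3 * real m) ^ (2 * k) * 3 ^ k)"
  proof -
    have "(real m + 2) ^ (k + 1) \<le> (3 * real m) ^ (k + 1)" using k by (intro power_mono) auto
    also have "\<dots> \<le> (3 * real m) ^ (2 * k)" using k assms(2) by (intro power_increasing) auto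
    finally show ?thesis by (intro mult_left_mono mult_right_mono) auto
  qed
  finally have W: "W \<le> 5 * (real r * (3 * real m) ^ (2 * k) * 3 ^ k)" .
  have Wpos: "W > 0" unfolding W_def of_nat_0_less_iff by simp
  have "ln W \<le> ln (5 * (real r * (3 * real m) ^ (2 * k) * 3 ^ k))"
    using W Wpos by (subst ln_le_cancel_iff) auto
  also have "\<dots> = ln 5 + (ln (real r) + 2 * real k * (ln 3 + ln (real m)) + real k * ln 3)"
    using r k by (simp add: ln_mult ln_realpow algebra_simps)
  also have "\<dots> \<le> 4 + (real r / 16 + 3) + 2 * real k * (2 + \<Lambda>) + real k * 2"
  proof -
    have "ln 5 \<le> (4::real)" "ln 3 \<le> (2::real)"
      using ln_le_minus_one[of "5::real"] ln_le_minus_one[of "3::real"] by auto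
    \<comment> \<open>The tangent bound for the logarithm is applied to \<open>r / 16\<close>, so
      that only a small fraction of \<open>r\<close> is spent.\<close>
    moreover have "ln (real r) \<le> real r / 16 + 3"
    proof -
      have "ln (real r / 16) \<le> real r / 16 - 1" using r by (intro ln_le_minus_one) auto
      moreover have "ln (real r / 16) = ln (real r) - ln 16" using r by (simp add: ln_div)
      moreover have "ln (16::real) = 4 * ln 2" using ln_realpow[of 2 4] by simp
      moreover have "ln (2::real) \<le> 1" using ln_le_minus_one[of "2::real"] by simp
      ultimately show ?thesis by linarith
    qed
    moreover have "2 * real k * (ln 3 + ln (real m)) \<le> 2 * real k * (2 + \<Lambda>)"
      using \<open>ln 3 \<le> 2\<close> assms(4) by (intro mult_left_mono) auto
    moreover have "real k * ln 3 \<le> real k * 2" using \<open>ln 3 \<le> 2\<close> by (intro mult_left_mono) auto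
    ultimately show ?thesis by linarith
  qed
  \<comment> \<open>The constant 7, the term \<open>6 * k\<close> and the term
    \<open>2 * k * \<Lambda>\<close> are each compared with \<open>k * \<Lambda>\<close>, which
    gives 7 + 6 + 2 = 15.\<close>
  also have "\<dots> \<le> real r / 16 + 15 * (real k * \<Lambda>)"
  proof -
    have "real k * 1 \<le> real k * \<Lambda>" using assms(3) by (intro mult_left_mono) auto
    then show ?thesis using \<open>1 \<le> real k * \<Lambda>\<close> by (simp add: algebra_simps)
  qed
  finally have "2 * ln W < real r * (2 / 3)" using assms(5) \<open>1 \<le> real k * \<Lambda>\<close> by simp
  also have "\<dots> \<le> real r * ln 2" using ln2_ge_two_thirds by (intro mult_left_mono) auto
  finally have "ln (W ^ 2) < ln (2 ^ r)" using Wpos by (simp add: ln_realpow)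
  then have "W ^ 2 < 2 ^ r" using Wpos by (subst (asm) ln_less_cancel_iff) auto
  then show ?thesis unfolding W_def using of_nat_less_iff[where 'a = real] by (metis of_nat_numeral of_nat_power)
qed

theorem theorem1:
  "\<exists>C::real. C > 0 \<and>
     (\<forall>(n::nat) (k::nat) (m::nat) (H::real) (Inst::lp_inst set).
        0 < k \<longrightarrow> k < n \<longrightarrow> 0 < m \<longrightarrow> 0 < H \<longrightarrow>
        Inst \<subseteq> lp_instances n m \<longrightarrow>
        (\<forall>\<pi>\<in>Inst. lp_feasible n m \<pi> (\<lambda>_. 0) \<and>
                 (\<forall>x. lp_feasible n m \<pi> x \<longrightarrow> lp_obj n \<pi> x \<le> H)) \<longrightarrow>
        pdim_on Inst {proj_lp_val n k m P | P. True} \<noteq> \<infinity> \<and>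
        real (the_enat (pdim_on Inst {proj_lp_val n k m P | P. True}))
          \<le> C * real n * real k ^ 2 * max 1 (ln (real m * real k)))"
proof (intro exI[of _ 61] conjI allI impI)
  fix n k m :: nat and H :: real and Inst :: "lp_inst set"
  assume pos: "0 < k" "k < n" "0 < m"
    and lp: "\<forall>\<pi>\<in>Inst. lp_feasible n m \<pi> (\<lambda>_. 0) \<and> (\<forall>x. lp_feasible n m \<pi> x \<longrightarrow> lp_obj n \<pi> x \<le> H)"
  let ?U = "{proj_lp_val n k m P | P. True}"
  define \<Lambda> where "\<Lambda> = max 1 (ln (real m * real k))"
  have \<Lambda>: "1 \<le> \<Lambda>" "ln (real m) \<le> \<Lambda>"
  proof -
    have "ln (real m) \<le> ln (real m * real k)" using pos by (subst ln_le_cancel_iff) auto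
    then show "1 \<le> \<Lambda>" "ln (real m) \<le> \<Lambda>" by (auto simp: \<Lambda>_def)
  qed
  \<comment> \<open>Rounding up costs at most 1, which is at most \<open>k * \<Lambda>\<close>; this
    turns 60 into the final constant 61.\<close>
  define r where "r = nat \<lceil>60 * real k * \<Lambda>\<rceil>"
  have k\<Lambda>: "1 \<le> real k * \<Lambda>" using pos \<Lambda> mult_mono[of 1 "real k" 1 \<Lambda>] by simp
  have r: "60 * real k * \<Lambda> \<le> real r" "real r \<le> 61 * (real k * \<Lambda>)"
    using k\<Lambda> unfolding r_def by linarith+
  have card_le: "card S \<le> n * k * r" if S: "finite S" "S \<subseteq> Inst" "pshatters ?U S" for S
  proof (rule ccontr)
    assume "\<not> card S \<le> n * k * r"
    \<comment> \<open>Shattering passes to subsets, so a set that is too large may be cut down to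
      exactly \<open>n * k\<close> blocks of \<open>r\<close> instances.\<close>
    then obtain S' where S': "S' \<subseteq> S" "card S' = n * k * r" "finite S'"
      using obtain_subset_with_card_n[of "n * k * r" S] by (metis nat_le_linear)
    let ?W = "2 * (r * (m + 2) ^ (k + 1)) * 3 ^ k + 3 :: nat"
    have "2 ^ (n * k * r) \<le> ?W ^ (n * k + n * k)"
      by (rule shattered_power_le[of S' n k r m H]) (use S' S lp pshatters_subset in auto)
    also have "\<dots> = (?W ^ 2) ^ (n * k)" by (simp only: power_mult[symmetric] mult_2)
    also have "\<dots> < (2 ^ r) ^ (n * k)"
      using threshold_growth[OF pos(3,1) \<Lambda> r(1)] pos by (intro power_strict_mono) auto
    also have "\<dots> = 2 ^ (n * k * r)" by (simp add: power_mult[symmetric] mult.commute)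
    finally show False by simp
  qed
  have le: "pdim_on Inst ?U \<le> enat (n * k * r)"
    unfolding pdim_on_def by (rule Sup_least) (use card_le in auto)
  show "pdim_on Inst ?U \<noteq> \<infinity>"
  proof
    assume "pdim_on Inst ?U = \<infinity>"
    with le have "\<infinity> \<le> enat (n * k * r)" by (simp only:)
    then show False by simp
  qed
  from le obtain d where d: "pdim_on Inst ?U = enat d" "d \<le> n * k * r"
    by (cases "pdim_on Inst ?U") auto
  have "real d \<le> real n * real k * real r" using d(2) by (metis of_nat_le_iff of_nat_mult)
  also have "\<dots> \<le> real n * real k * (61 * (real k * \<Lambda>))" using r(2) by (intro mult_left_mono) auto
  finally show "real (the_enat (pdim_on Inst ?U)) \<le> 61 * real n * real k ^ 2 * max 1 (ln (real m * real k))"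
    using d(1) by (simp add: \<Lambda>_def power2_eq_square algebra_simps)
qed simp

end
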